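(* Let $\mathcal{H}$ be a complex Hilbert space and let $A\in\mathcal{B}(\mathcal{H})$. Then for any $0\le t\le 1$, \[\left\|\mathfrak{R}A\right\|\le\frac{\omega_r(A)}{2R}\le\omega(A),\] where $r=\min\{t,1-t\}$ and $R=\max\{t,1-t\}$. In particular, \[\left\|\mathfrak{R}A\right\|\le\frac43\int_0^{\frac12}\omega_t(A)\,dt\le\omega(A).\]
   Context: $\mathcal{B}(\mathcal{H})$ is the $C^*$-algebra of bounded linear operators on the complex Hilbert space $\mathcal{H}$, with operator norm $\|\cdot\|$. $\mathfrak{R}A=\frac{A+A^*}{2}$. The numerical radius is $\omega(A)=\sup_{\|x\|=1}|\langle Ax,x\rangle|$. For $0\le s\le 1$, the $s$-weighted numerical radius of $A$ is $\omega_s(A)=\omega\left((1-2s)A^*+A\right)$. *)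

theory Defs
  imports "HOL-Analysis.Analysis"
begin

class complex_vector = real_vector +
  fixes scaleC :: "complex \<Rightarrow> 'a \<Rightarrow> 'a" (infixr "*\<^sub>C" 75)
  assumes scaleC_add_right: "c *\<^sub>C (x + y) = c *\<^sub>C x + c *\<^sub>C y"
    and scaleC_add_left: "(c + d) *\<^sub>C x = c *\<^sub>C x + d *\<^sub>C x"
    and scaleC_scaleC: "c *\<^sub>C (d *\<^sub>C x) = (c * d) *\<^sub>C x"
    and scaleC_one: "1 *\<^sub>C x = x"
    and scaleR_scaleC: "r *\<^sub>R x = complex_of_real r *\<^sub>C x"

text \<open>The inner product is linear in its first argument.\<close>

class complex_inner = complex_vector + real_normed_vector +
  fixes cinner :: "'a \<Rightarrow> 'a \<Rightarrow> complex"
  assumes cinner_add_left: "cinner (x + y) z = cinner x z + cinner y z"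
    and cinner_scaleC_left: "cinner (c *\<^sub>C x) y = c * cinner x y"
    and cinner_commute: "cinner y x = cnj (cinner x y)"
    and cinner_self_ge_zero: "0 \<le> Re (cinner x x)"
    and cinner_self_eq_zero_iff: "cinner x x = 0 \<longleftrightarrow> x = 0"
    and norm_eq_sqrt_cinner: "norm x = sqrt (Re (cinner x x))"

class complex_hilbert = complex_inner + banach

text \<open>
  Elements of \<open>B(H)\<close> are represented as functions satisfying the following predicate;
  their operator norm is the library's \<^const>\<open>onorm\<close>.
\<close>

definition bounded_clinear :: "('a::complex_inner \<Rightarrow> 'b::complex_inner) \<Rightarrow> bool" where
  "bounded_clinear A \<longleftrightarrow> bounded_linear A \<and> (\<forall>c x. A (c *\<^sub>C x) = c *\<^sub>C A x)"

text \<open>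
  For a bounded operator on a Hilbert space the adjoint exists by the Riesz representation
  theorem, and it is unique.
\<close>

definition cadjoint :: "('a::complex_hilbert \<Rightarrow> 'a) \<Rightarrow> 'a \<Rightarrow> 'a" where
  "cadjoint A = (THE B. \<forall>x y. cinner (A x) y = cinner x (B y))"

definition real_part :: "('a::complex_hilbert \<Rightarrow> 'a) \<Rightarrow> 'a \<Rightarrow> 'a" where
  "real_part A = (\<lambda>x. (1/2) *\<^sub>C (A x + cadjoint A x))"

text \<open>
  The supremum is taken in the nonnegative reals: the inserted 0 only matters for the zero
  space, which has no unit vectors and where \<^term>\<open>Sup {} :: real\<close> is unspecified.
\<close>

definition numerical_radius :: "('a::complex_inner \<Rightarrow> 'a) \<Rightarrow> real" where
  "numerical_radius A = Sup (insert 0 {cmod (cinner (A x) x) | x. norm x = 1})"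

definition weighted_numerical_radius :: "real \<Rightarrow> ('a::complex_hilbert \<Rightarrow> 'a) \<Rightarrow> real" where
  "weighted_numerical_radius s A =
     numerical_radius (\<lambda>x. complex_of_real (1 - 2 * s) *\<^sub>C cadjoint A x + A x)"

end

theory Submission
  imports Defs
begin

text \<open>
  Put \<open>z = \<langle>Ax, x\<rangle>\<close> for a unit vector \<open>x\<close>. The quadratic form of \<open>(1 - 2s)A\<^sup>* + A\<close> at \<open>x\<close> is
  \<open>(1 - 2s) cnj z + z = 2(1 - s) Re z + 2s \<i> Im z\<close>, so for \<open>0 \<le> s \<le> 1/2\<close> its modulus lies between
  \<open>2(1 - s) \<bar>Re z\<bar>\<close> and \<open>2(1 - s) \<bar>z\<bar>\<close>. Taking suprema, and using that the norm of a self-adjoint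
  operator is its numerical radius, gives the first claim. The second follows by integrating
  over \<open>s\<close>, as \<open>2(1 - s)\<close> has integral \<open>3/4\<close>.
\<close>

section \<open>Inner product algebra and the Cauchy-Schwarz inequality\<close>

lemma cinner_add_right:
  fixes x y z :: "'a::complex_inner"
  shows "cinner x (y + z) = cinner x y + cinner x z"
  by (metis cinner_add_left cinner_commute complex_cnj_add)

lemma cinner_scaleC_right:
  fixes x y :: "'a::complex_inner"
  shows "cinner x (c *\<^sub>C y) = cnj c * cinner x y"
  by (metis cinner_scaleC_left cinner_commute complex_cnj_mult)

lemma cinner_scaleR_left:
  fixes x y :: "'a::complex_inner"
  shows "cinner (r *\<^sub>R x) y = of_real r * cinner x y"
  by (simp add: scaleR_scaleC cinner_scaleC_left)

lemma cinner_scaleR_right: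
  fixes x y :: "'a::complex_inner"
  shows "cinner x (r *\<^sub>R y) = of_real r * cinner x y"
  by (simp add: scaleR_scaleC cinner_scaleC_right)

lemma cinner_minus_left:
  fixes x y :: "'a::complex_inner"
  shows "cinner (- x) y = - cinner x y"
  using cinner_scaleR_left[of "-1" x y] by simp

lemma cinner_minus_right:
  fixes x y :: "'a::complex_inner"
  shows "cinner x (- y) = - cinner x y"
  using cinner_scaleR_right[of x "-1" y] by simp

lemma cinner_diff_left:
  fixes x y z :: "'a::complex_inner"
  shows "cinner (x - y) z = cinner x z - cinner y z"
  using cinner_add_left[of x "- y" z] by (simp add: cinner_minus_left)

lemma cinner_diff_right:
  fixes x y z :: "'a::complex_inner"
  shows "cinner x (y - z) = cinner x y - cinner x z"
  using cinner_add_right[of x y "- z"] by (simp add: cinner_minus_right)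

lemma Re_cinner_commute:
  fixes x y :: "'a::complex_inner"
  shows "Re (cinner y x) = Re (cinner x y)"
  by (subst cinner_commute) simp

lemma norm_sq_eq_cinner:
  fixes x :: "'a::complex_inner"
  shows "(norm x)\<^sup>2 = Re (cinner x x)"
  by (simp add: norm_eq_sqrt_cinner cinner_self_ge_zero)

lemma norm_sq_add:
  fixes x y :: "'a::complex_inner"
  shows "(norm (x + y))\<^sup>2 = (norm x)\<^sup>2 + 2 * Re (cinner x y) + (norm y)\<^sup>2"
  using Re_cinner_commute[of x y]
  by (simp add: norm_sq_eq_cinner cinner_add_left cinner_add_right)

lemma norm_sq_diff:
  fixes x y :: "'a::complex_inner"
  shows "(norm (x - y))\<^sup>2 = (norm x)\<^sup>2 - 2 * Re (cinner x y) + (norm y)\<^sup>2"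
  using norm_sq_add[of x "- y"] by (simp add: cinner_minus_right)

lemma norm_scaleC:
  fixes x :: "'a::complex_inner"
  shows "norm (c *\<^sub>C x) = cmod c * norm x"
proof -
  have "(norm (c *\<^sub>C x))\<^sup>2 = Re ((c * cnj c) * cinner x x)"
    by (simp only: norm_sq_eq_cinner cinner_scaleC_left cinner_scaleC_right mult_ac)
  also have "\<dots> = Re (of_real ((cmod c)\<^sup>2) * cinner x x)"
    by (simp only: complex_norm_square)
  also have "\<dots> = (cmod c * norm x)\<^sup>2"
    by (simp add: power_mult_distrib norm_sq_eq_cinner del: of_real_power)
  finally show ?thesis by (simp add: power2_eq_iff_nonneg)
qed

text \<open>The usual derivation is reversed: the triangle inequality already belongs to the normed
  space, and squaring and expanding it leaves exactly this bound.\<close>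

lemma Re_cinner_le:
  fixes x y :: "'a::complex_inner"
  shows "Re (cinner x y) \<le> norm x * norm y"
proof -
  have "(norm (x + y))\<^sup>2 \<le> (norm x + norm y)\<^sup>2"
    by (simp add: power_mono norm_triangle_ineq)
  then show ?thesis by (simp add: norm_sq_add power2_sum)
qed

text \<open>Multiplying \<open>x\<close> by the unimodular scalar that makes the inner product real
  and nonnegative keeps its norm and reduces the claim to \<open>Re_cinner_le\<close>.\<close>

lemma cmod_cinner_le:
  fixes x y :: "'a::complex_inner"
  shows "cmod (cinner x y) \<le> norm x * norm y"
proof (cases "cinner x y = 0")
  case False
  define c where "c = cnj (sgn (cinner x y))"
  have "c * cinner x y = of_real (cmod (cinner x y))"
    using False unfolding c_def sgn_eq
    by (simp add: mult.commute[of "cnj _"] complex_norm_square[symmetric] power2_eq_square)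
  then have "cmod (cinner x y) = Re (cinner (c *\<^sub>C x) y)"
    by (simp add: cinner_scaleC_left)
  also have "\<dots> \<le> norm (c *\<^sub>C x) * norm y"
    by (rule Re_cinner_le)
  also have "\<dots> = norm x * norm y"
    using False by (simp add: norm_scaleC c_def norm_sgn)
  finally show ?thesis .
qed simp

section \<open>Riesz representation and existence of the adjoint\<close>

text \<open>
  The Riesz vector is the minimiser of \<open>\<parallel>x\<parallel>\<^sup>2 - 2 g x\<close>; minimising sequences are Cauchy by the
  parallelogram law.
\<close>

lemma real_riesz_representation:
  fixes g :: "'a::complex_hilbert \<Rightarrow> real"
  assumes g: "bounded_linear g"
  obtains b where "\<And>x. g x = Re (cinner x b)"
proof -
  interpret g: bounded_linear g by fact
  define J where "J x = (norm x)\<^sup>2 - 2 * g x" for x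
  obtain K where K: "\<And>x. norm (g x) \<le> norm x * K"
    using g.bounded by blast
  have lower: "- (K\<^sup>2) \<le> J x" for x
  proof -
    have "g x \<le> norm x * K" using K[of x] by simp
    moreover have "0 \<le> (norm x - K)\<^sup>2" by simp
    ultimately show ?thesis by (simp add: J_def power2_diff)
  qed
  define m where "m = Inf (range J)"
  have bdd: "bdd_below (range J)" using lower by (intro bdd_belowI[of _ "- (K\<^sup>2)"]) auto
  have m_le: "m \<le> J x" for x
    unfolding m_def using bdd by (simp add: cInf_lower)
  have "\<exists>x. J x < m + inverse (real (Suc n))" for n
    using cInf_lessD[of "range J" "m + inverse (real (Suc n))"] by (auto simp: m_def)
  then obtain X where X: "\<And>n. J (X n) < m + inverse (real (Suc n))"
    by metis
  have par: "(norm (x - y))\<^sup>2 \<le> 2 * (J x - m) + 2 * (J y - m)" for x y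
  proof -
    \<comment> \<open>The midpoint cannot go below the infimum \<open>m\<close>; inserted into the
      parallelogram law, this bounds the distance of \<open>x\<close> and \<open>y\<close> by their
      excesses over \<open>m\<close>.\<close>
    have "J ((1/2) *\<^sub>R (x + y)) = (norm (x + y))\<^sup>2 / 4 - (g x + g y)"
      by (simp add: J_def g.scaleR g.add power_divide add_divide_distrib del: scaleR_add_right)
    then have "m \<le> (norm (x + y))\<^sup>2 / 4 - (g x + g y)"
      using m_le by metis
    then show ?thesis
      using norm_sq_add[of x y] norm_sq_diff[of x y] unfolding J_def by argo
  qed
  have "Cauchy X"
  proof (rule metric_CauchyI)
    fix e :: real
    assume e: "0 < e"
    \<comment> \<open>\<open>par\<close> weighs each of two excesses by 2, so excesses below
      \<open>e\<^sup>2 / 4\<close> keep the squared distance below \<open>e\<^sup>2\<close>.\<close>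
    then have e2: "0 < e\<^sup>2 / 4" by simp
    obtain N where N: "inverse (real (Suc N)) < e\<^sup>2 / 4"
      using reals_Archimedean[OF e2] by blast
    have close: "J (X n) - m < e\<^sup>2 / 4" if "N \<le> n" for n
    proof -
      have "inverse (real (Suc n)) \<le> inverse (real (Suc N))"
        using that by (intro le_imp_inverse_le) auto
      then show ?thesis using X[of n] N by linarith
    qed
    show "\<exists>M. \<forall>i\<ge>M. \<forall>n\<ge>M. dist (X i) (X n) < e"
    proof (intro exI allI impI)
      fix i n
      assume "N \<le> i" "N \<le> n"
      then have "(norm (X i - X n))\<^sup>2 < e\<^sup>2"
        using par[of "X i" "X n"] close[of i] close[of n] by (simp add: algebra_simps)
      then show "dist (X i) (X n) < e"
        using e by (simp add: dist_norm power2_less_imp_less)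
    qed
  qed
  then obtain b where b: "X \<longlonglongrightarrow> b"
    using Cauchy_convergent_iff convergent_def by blast
  have lim: "(\<lambda>n. J (X n)) \<longlonglongrightarrow> J b"
    unfolding J_def by (intro tendsto_intros g.tendsto b)
  have "J b \<le> m"
  proof (rule LIMSEQ_le[OF lim])
    show "(\<lambda>n. m + inverse (real (Suc n))) \<longlonglongrightarrow> m"
      using tendsto_add[OF tendsto_const LIMSEQ_inverse_real_of_nat] by simp
    show "\<exists>N. \<forall>n\<ge>N. J (X n) \<le> m + inverse (real (Suc n))"
      using X less_imp_le by blast
  qed
  then have min: "J b \<le> J x" for x using m_le order_trans by blast
  have "g x = Re (cinner x b)" for x
  proof (cases "x = 0")
    case True
    then show ?thesis using g.zero cinner_scaleR_left[of 0 b b] by simp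
  next
    case False
    define d where "d = g x - Re (cinner x b)"
    \<comment> \<open>This \<open>t\<close> minimises the quadratic
      \<open>J (b + t *\<^sub>R x)\<close> in the step length. It would lower \<open>J\<close> by
      \<open>d\<^sup>2 / (norm x)\<^sup>2\<close>, so minimality of \<open>b\<close> forces
      \<open>d = 0\<close>.\<close>
    define t where "t = d / (norm x)\<^sup>2"
    have "J (b + t *\<^sub>R x) = J b + t\<^sup>2 * (norm x)\<^sup>2 - 2 * t * d"
      by (simp add: J_def d_def norm_sq_add g.add g.scaleR cinner_scaleR_right
          Re_cinner_commute[of x b] power_mult_distrib algebra_simps)
    then have "0 \<le> t\<^sup>2 * (norm x)\<^sup>2 - 2 * t * d"
      using min[of "b + t *\<^sub>R x"] by simp
    also have "\<dots> = - (d\<^sup>2 / (norm x)\<^sup>2)"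
      using False by (simp add: t_def field_simps power2_eq_square)
    finally have "d\<^sup>2 / (norm x)\<^sup>2 \<le> 0" by simp
    then have "d = 0"
      using False by (simp add: divide_le_0_iff)
    then show ?thesis by (simp add: d_def)
  qed
  then show thesis by (rule that)
qed

text \<open>Justifies the definite description behind \<open>cadjoint\<close>. Existence is Riesz
  applied, for each fixed second argument, to the real part of the left-hand side; uniqueness is
  definiteness of the inner product.\<close>

lemma cinner_cadjoint:
  fixes A :: "'a::complex_hilbert \<Rightarrow> 'a"
  assumes A: "bounded_clinear A"
  shows "cinner (A x) y = cinner x (cadjoint A y)"
proof -
  interpret A: bounded_linear A using A by (simp add: bounded_clinear_def)
  have scale: "A (c *\<^sub>C u) = c *\<^sub>C A u" for c u
    using A by (simp add: bounded_clinear_def)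
  have "\<exists>b. \<forall>u. cinner (A u) v = cinner u b" for v
  proof -
    have "bounded_linear (\<lambda>u. Re (cinner (A u) v))"
    proof (rule bounded_linear_intro)
      show "norm (Re (cinner (A u) v)) \<le> norm u * (onorm A * norm v)" for u
      proof -
        have "norm (Re (cinner (A u) v)) \<le> norm (A u) * norm v"
          using abs_Re_le_cmod cmod_cinner_le order_trans by fastforce
        also have "\<dots> \<le> (onorm A * norm u) * norm v"
          by (intro mult_right_mono onorm A.bounded_linear_axioms) auto
        finally show ?thesis by (simp add: mult_ac)
      qed
    qed (simp_all add: A.add A.scaleR cinner_add_left cinner_scaleR_left)
    then obtain b where b: "\<And>u. Re (cinner (A u) v) = Re (cinner u b)"
      using real_riesz_representation by blast
    \<comment> \<open>Complex linearity recovers the imaginary part, since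
      \<open>Re (- \<i> * z) = Im z\<close>.\<close>
    have "Im (cinner (A u) v) = Im (cinner u b)" for u
      using b[of "(- \<i>) *\<^sub>C u"] by (simp add: scale cinner_scaleC_left)
    with b show ?thesis by (metis complex_eqI)
  qed
  then obtain B where B: "\<And>u v. cinner (A u) v = cinner u (B v)"
    by metis
  have "\<exists>!B. \<forall>u v. cinner (A u) v = cinner u (B v)"
  proof (rule ex1I)
    show "\<forall>u v. cinner (A u) v = cinner u (B v)" using B by blast
    fix C
    assume "\<forall>u v. cinner (A u) v = cinner u (C v)"
    then have "cinner (C v - B v) (C v - B v) = 0" for v
      by (simp add: B cinner_diff_right)
    then show "C = B" by (auto simp: cinner_self_eq_zero_iff)
  qed
  then have "\<forall>u v. cinner (A u) v = cinner u (cadjoint A v)"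
    unfolding cadjoint_def by (rule theI')
  then show ?thesis by blast
qed

section \<open>The norm of the real part from its quadratic form\<close>

text \<open>The real part is self-adjoint with quadratic form \<open>Re (cinner (A x) x)\<close>.
  Polarisation expresses its off-diagonal values by that form, and the parallelogram law then keeps
  the constant \<open>c\<close> without loss.\<close>

lemma onorm_real_part_le:
  fixes A :: "'a::complex_hilbert \<Rightarrow> 'a"
  assumes A: "bounded_clinear A" and c: "0 \<le> c"
    and le: "\<And>x. norm x = 1 \<Longrightarrow> \<bar>Re (cinner (A x) x)\<bar> \<le> c"
  shows "onorm (real_part A) \<le> c"
proof (rule onorm_bound[OF c])
  interpret A: bounded_linear A using A by (simp add: bounded_clinear_def)
  have quad: "\<bar>Re (cinner (A x) x)\<bar> \<le> c * (norm x)\<^sup>2" for x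
  proof (cases "x = 0")
    case True
    then show ?thesis using A.zero cinner_scaleR_left[of 0 x x] by simp
  next
    case False
    have "\<bar>Re (cinner (A (sgn x)) (sgn x))\<bar> \<le> c"
      using False by (intro le) (simp add: norm_sgn)
    moreover have "Re (cinner (A (sgn x)) (sgn x)) = Re (cinner (A x) x) / (norm x)\<^sup>2"
      by (simp add: sgn_div_norm A.scaleR cinner_scaleR_left cinner_scaleR_right
          power2_eq_square field_simps)
    ultimately show ?thesis
      using False by (simp add: abs_divide pos_divide_le_eq)
  qed
  fix x
  define T where "T = real_part A x"
  show "norm (real_part A x) \<le> c * norm x"
  proof (cases "T = 0 \<or> x = 0")
    case True
    moreover have "T = 0" if "x = 0"
    proof -
      have "cinner T T = 0"
      proof -
        \<comment> \<open>The value of the adjoint at 0 is read off from the adjoint identity and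
          definiteness, without appeal to its linearity.\<close>
        have *: "cinner u (cadjoint A 0) = 0" for u
          using cinner_cadjoint[OF A, of u 0] cinner_scaleR_right[of "A u" 0 u] by simp
        then have "cadjoint A 0 = 0" using cinner_self_eq_zero_iff by blast
        then have "T = (1/2) *\<^sub>C 0" using that A.zero by (simp add: T_def real_part_def)
        then show ?thesis
          using cinner_scaleC_left[of "1/2" 0 T] cinner_scaleR_left[of 0 T T] by simp
      qed
      then show ?thesis by (simp add: cinner_self_eq_zero_iff)
    qed
    ultimately show ?thesis using c by (auto simp: T_def)
  next
    case False
    \<comment> \<open>\<open>y\<close> is \<open>T\<close> rescaled to the length of
      \<open>x\<close>. Its direction makes \<open>Re (cinner T y)\<close> equal to
      \<open>norm x * norm T\<close>; its length makes the parallelogram sum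
      \<open>4 * (norm x)\<^sup>2\<close>.\<close>
    define r where "r = norm x / norm T"
    define y where "y = r *\<^sub>R T"
    have norm_y: "norm y = norm x" using False by (simp add: y_def r_def)
    have Re_T: "2 * Re (cinner T y) = Re (cinner (A x) y) + Re (cinner (A y) x)"
      using Re_cinner_commute[of "cadjoint A x" y]
      by (simp add: T_def real_part_def cinner_scaleC_left cinner_add_left cinner_cadjoint[OF A])
    \<comment> \<open>The diagonal terms cancel in the difference and each cross term survives
      twice.\<close>
    have "4 * Re (cinner T y)
        = Re (cinner (A (x + y)) (x + y)) - Re (cinner (A (x - y)) (x - y))"
      using Re_T by (simp add: A.add A.diff cinner_add_left cinner_add_right
          cinner_diff_left cinner_diff_right)
    also have "\<dots> \<le> c * (norm (x + y))\<^sup>2 + c * (norm (x - y))\<^sup>2"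
      using quad[of "x + y"] quad[of "x - y"] by linarith
    also have "\<dots> = 4 * (c * (norm x)\<^sup>2)"
      by (simp add: norm_sq_add norm_sq_diff norm_y algebra_simps)
    finally have "Re (cinner T y) \<le> c * (norm x)\<^sup>2" by simp
    moreover have "Re (cinner T y) = norm x * norm T"
      using False by (simp add: y_def r_def cinner_scaleR_right norm_sq_eq_cinner[symmetric]
          power2_eq_square)
    ultimately have "norm T \<le> c * norm x"
      using False by (simp add: power2_eq_square)
    then show ?thesis by (simp add: T_def)
  qed
qed

section \<open>The numerical radius as a supremum\<close>

lemma numerical_radius_le:
  assumes "0 \<le> c" "\<And>x. norm x = 1 \<Longrightarrow> cmod (cinner (A x) x) \<le> c"
  shows "numerical_radius A \<le> c"
  unfolding numerical_radius_def using assms by (intro cSup_least) auto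

text \<open>A real \<open>Sup\<close> dominates its set only if the set is bounded. Any crude
  \<open>K\<close> will do; multiples of the operator norm provide it below.\<close>

lemma bdd_above_numerical_range:
  assumes "\<And>x. norm x = 1 \<Longrightarrow> cmod (cinner (A x) x) \<le> K"
  shows "bdd_above (insert 0 {cmod (cinner (A x) x) | x. norm x = 1})"
  using assms by (subst bdd_above_insert) (auto intro!: bdd_aboveI[of _ K])

lemma cmod_cinner_le_numerical_radius:
  assumes "\<And>x. norm x = 1 \<Longrightarrow> cmod (cinner (A x) x) \<le> K" "norm x = 1"
  shows "cmod (cinner (A x) x) \<le> numerical_radius A"
  unfolding numerical_radius_def
  using assms(2) by (intro cSup_upper bdd_above_numerical_range[OF assms(1)]) auto

lemma numerical_radius_nonneg:
  assumes "\<And>x. norm x = 1 \<Longrightarrow> cmod (cinner (A x) x) \<le> K"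
  shows "0 \<le> numerical_radius A"
  unfolding numerical_radius_def
  by (intro cSup_upper bdd_above_numerical_range[OF assms]) auto

lemma cmod_cinner_le_onorm:
  fixes A :: "'a::complex_inner \<Rightarrow> 'a"
  assumes "bounded_clinear A" "norm x = 1"
  shows "cmod (cinner (A x) x) \<le> onorm A"
proof -
  have "cmod (cinner (A x) x) \<le> norm (A x) * norm x"
    by (rule cmod_cinner_le)
  also have "\<dots> \<le> onorm A"
    using onorm[of A x] assms by (simp add: bounded_clinear_def)
  finally show ?thesis .
qed

section \<open>The weighted numerical radius of a fixed operator\<close>

context
  fixes A :: "'a::complex_hilbert \<Rightarrow> 'a"
  assumes A: "bounded_clinear A"
begin

lemma numerical_radius_upper: "norm x = 1 \<Longrightarrow> cmod (cinner (A x) x) \<le> numerical_radius A"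
  by (rule cmod_cinner_le_numerical_radius) (rule cmod_cinner_le_onorm[OF A])

lemma numerical_radius_ge_0: "0 \<le> numerical_radius A"
  by (rule numerical_radius_nonneg) (rule cmod_cinner_le_onorm[OF A])

lemma cinner_weighted:
  "cinner (complex_of_real (1 - 2 * s) *\<^sub>C cadjoint A x + A x) x
    = of_real (1 - 2 * s) * cnj (cinner (A x) x) + cinner (A x) x"
  by (simp add: cinner_add_left cinner_scaleC_left cinner_cadjoint[OF A]
      cinner_commute[of "cadjoint A x" x])

lemma cmod_weighted_le:
  "cmod (of_real (1 - 2 * s) * cnj z + z) \<le> (\<bar>1 - 2 * s\<bar> + 1) * cmod z"
proof -
  have "cmod (of_real (1 - 2 * s) * cnj z + z) \<le> cmod (of_real (1 - 2 * s) * cnj z) + cmod z"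
    by (rule norm_triangle_ineq)
  then show ?thesis by (simp add: norm_mult algebra_simps del: of_real_diff)
qed

lemma cmod_weighted_le_onorm:
  assumes "norm x = 1"
  shows "cmod (cinner (complex_of_real (1 - 2 * s) *\<^sub>C cadjoint A x + A x) x)
    \<le> (\<bar>1 - 2 * s\<bar> + 1) * onorm A"
  unfolding cinner_weighted
  by (rule order_trans[OF cmod_weighted_le])
     (intro mult_left_mono cmod_cinner_le_onorm A assms, simp)

lemma weighted_numerical_radius_upper:
  assumes "norm x = 1"
  shows "cmod (of_real (1 - 2 * s) * cnj (cinner (A x) x) + cinner (A x) x)
    \<le> weighted_numerical_radius s A"
  unfolding weighted_numerical_radius_def cinner_weighted[symmetric]
  by (rule cmod_cinner_le_numerical_radius) (rule cmod_weighted_le_onorm, assumption, fact)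

lemma weighted_numerical_radius_nonneg: "0 \<le> weighted_numerical_radius s A"
  unfolding weighted_numerical_radius_def
  by (rule numerical_radius_nonneg) (rule cmod_weighted_le_onorm)

lemma weighted_numerical_radius_le:
  assumes "s \<le> 1/2"
  shows "weighted_numerical_radius s A \<le> 2 * (1 - s) * numerical_radius A"
  unfolding weighted_numerical_radius_def
proof (rule numerical_radius_le)
  show "0 \<le> 2 * (1 - s) * numerical_radius A"
    using assms numerical_radius_ge_0 by simp
  fix x :: 'a
  assume x: "norm x = 1"
  have "cmod (cinner (complex_of_real (1 - 2 * s) *\<^sub>C cadjoint A x + A x) x)
      \<le> (\<bar>1 - 2 * s\<bar> + 1) * cmod (cinner (A x) x)"
    unfolding cinner_weighted by (rule cmod_weighted_le)
  \<comment> \<open>For \<open>s \<le> 1/2\<close> the absolute value opens as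
    \<open>1 - 2 * s\<close>, which produces the factor \<open>2 * (1 - s)\<close>.\<close>
  also have "\<dots> = 2 * (1 - s) * cmod (cinner (A x) x)"
    using assms by simp
  also have "\<dots> \<le> 2 * (1 - s) * numerical_radius A"
    using assms numerical_radius_upper[OF x] by (intro mult_left_mono) auto
  finally show "cmod (cinner (complex_of_real (1 - 2 * s) *\<^sub>C cadjoint A x + A x) x)
      \<le> 2 * (1 - s) * numerical_radius A" .
qed

lemma onorm_real_part_le_weighted:
  assumes "s \<le> 1/2"
  shows "2 * (1 - s) * onorm (real_part A) \<le> weighted_numerical_radius s A"
proof -
  have s: "0 < 2 * (1 - s)" using assms by simp
  have "onorm (real_part A) \<le> weighted_numerical_radius s A / (2 * (1 - s))"
  proof (rule onorm_real_part_le[OF A])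
    show "0 \<le> weighted_numerical_radius s A / (2 * (1 - s))"
      using s weighted_numerical_radius_nonneg by simp
    fix x :: 'a
    assume x: "norm x = 1"
    define z where "z = cinner (A x) x"
    \<comment> \<open>Conjugation fixes the real part, so the weights \<open>1 - 2 * s\<close> and 1
      add up on it; the imaginary part is then discarded.\<close>
    have "\<bar>Re z\<bar> * (2 * (1 - s)) = \<bar>Re (of_real (1 - 2 * s) * cnj z + z)\<bar>"
    proof -
      have "Re (of_real (1 - 2 * s) * cnj z + z) = Re z * (2 * (1 - s))"
        by (simp add: algebra_simps)
      then show ?thesis using s by (metis abs_mult abs_of_pos)
    qed
    also have "\<dots> \<le> cmod (of_real (1 - 2 * s) * cnj z + z)"
      by (rule abs_Re_le_cmod)
    also have "\<dots> \<le> weighted_numerical_radius s A"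
      unfolding z_def by (rule weighted_numerical_radius_upper[OF x])
    finally show "\<bar>Re (cinner (A x) x)\<bar> \<le> weighted_numerical_radius s A / (2 * (1 - s))"
      using s by (simp add: pos_le_divide_eq z_def)
  qed
  then show ?thesis using s by (simp add: pos_le_divide_eq mult.commute)
qed

text \<open>Changing the weight from \<open>t\<close> to \<open>s\<close> perturbs the quadratic
  form only by \<open>2 * (t - s)\<close> times \<open>cnj z\<close>. Used in both directions, this
  is a Lipschitz estimate in the weight.\<close>

lemma weighted_numerical_radius_diff_le:
  "weighted_numerical_radius s A \<le> weighted_numerical_radius t A + 2 * \<bar>s - t\<bar> * numerical_radius A"
  unfolding weighted_numerical_radius_def[of s]
proof (rule numerical_radius_le)
  show "0 \<le> weighted_numerical_radius t A + 2 * \<bar>s - t\<bar> * numerical_radius A"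
    using weighted_numerical_radius_nonneg numerical_radius_ge_0 by simp
  fix x :: 'a
  assume x: "norm x = 1"
  define z where "z = cinner (A x) x"
  have "of_real (1 - 2 * s) * cnj z + z
      = (of_real (1 - 2 * t) * cnj z + z) + of_real (2 * (t - s)) * cnj z"
    by (simp add: algebra_simps)
  then have "cmod (of_real (1 - 2 * s) * cnj z + z)
      \<le> cmod (of_real (1 - 2 * t) * cnj z + z) + cmod (of_real (2 * (t - s)) * cnj z)"
    by (metis norm_triangle_ineq)
  also have "cmod (of_real (2 * (t - s)) * cnj z) = 2 * \<bar>s - t\<bar> * cmod z"
    by (simp only: norm_mult norm_of_real complex_mod_cnj abs_mult abs_minus_commute[of t s]
        abs_numeral)
  also have "cmod (of_real (1 - 2 * t) * cnj z + z) + 2 * \<bar>s - t\<bar> * cmod z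
      \<le> weighted_numerical_radius t A + 2 * \<bar>s - t\<bar> * numerical_radius A"
    unfolding z_def
    by (intro add_mono mult_left_mono weighted_numerical_radius_upper numerical_radius_upper x) auto
  finally show "cmod (cinner (complex_of_real (1 - 2 * s) *\<^sub>C cadjoint A x + A x) x)
      \<le> weighted_numerical_radius t A + 2 * \<bar>s - t\<bar> * numerical_radius A"
    by (simp only: cinner_weighted z_def)
qed

text \<open>Supplies the integrability of the weighted radius over the compact interval.\<close>

lemma continuous_on_weighted_numerical_radius:
  "continuous_on S (\<lambda>t. weighted_numerical_radius t A)"
proof (rule lipschitz_on_continuous_on)
  show "(2 * numerical_radius A)-lipschitz_on S (\<lambda>t. weighted_numerical_radius t A)"
  proof (rule lipschitz_onI)
    show "dist (weighted_numerical_radius s A) (weighted_numerical_radius t A)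
        \<le> 2 * numerical_radius A * dist s t" for s t
      using weighted_numerical_radius_diff_le[of s t] weighted_numerical_radius_diff_le[of t s]
      by (simp add: dist_real_def abs_le_iff abs_minus_commute mult_ac)
  qed (simp add: numerical_radius_ge_0)
qed

end

section \<open>Integration over the weight and the conclusion\<close>

lemma has_integral_weight:
  "((\<lambda>t::real. 2 * (1 - t) * c) has_integral (3/4 * c)) {0..1/2}"
proof -
  \<comment> \<open>The value is left unevaluated so that the antiderivative
    \<open>(2 * t - t\<^sup>2) * c\<close> can be matched at both end points.\<close>
  have "((\<lambda>t::real. 2 * (1 - t) * c) has_integral
      ((2 * (1/2) - (1/2)\<^sup>2) * c - (2 * 0 - 0\<^sup>2) * c)) {0..1/2}"
    by (rule fundamental_theorem_of_calculus)
       (auto intro!: derivative_eq_intros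
          simp flip: has_real_derivative_iff_has_vector_derivative simp: algebra_simps)
  then show ?thesis by (simp add: power2_eq_square)
qed

theorem corollary2p2:
  fixes A :: "'a::complex_hilbert \<Rightarrow> 'a"
  assumes "bounded_clinear A"
  shows "(\<forall>t::real. 0 \<le> t \<and> t \<le> 1 \<longrightarrow>
           (let r = min t (1 - t); R = max t (1 - t) in
             onorm (real_part A) \<le> weighted_numerical_radius r A / (2 * R) \<and>
             weighted_numerical_radius r A / (2 * R) \<le> numerical_radius A)) \<and>
         (\<lambda>t. weighted_numerical_radius t A) integrable_on {0..1/2} \<and>
         onorm (real_part A) \<le> 4/3 * integral {0..1/2} (\<lambda>t. weighted_numerical_radius t A) \<and>
         4/3 * integral {0..1/2} (\<lambda>t. weighted_numerical_radius t A) \<le> numerical_radius A"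
proof (intro conjI allI impI)
  let ?w = "\<lambda>t. weighted_numerical_radius t A"
  show int: "?w integrable_on {0..1/2}"
    by (intro integrable_continuous_interval continuous_on_weighted_numerical_radius assms)
  \<comment> \<open>The pointwise bounds hold for every weight in the interval, so both sides may be
    integrated; \<open>c\<close> in \<open>has_integral_weight\<close> is the norm here and the
    numerical radius below.\<close>
  have "3/4 * onorm (real_part A) \<le> integral {0..1/2} ?w"
    using onorm_real_part_le_weighted[OF assms]
    by (intro has_integral_le[OF has_integral_weight integrable_integral[OF int]]) auto
  then show "onorm (real_part A) \<le> 4/3 * integral {0..1/2} ?w" by simp
  have "integral {0..1/2} ?w \<le> 3/4 * numerical_radius A"
    using weighted_numerical_radius_le[OF assms]
    by (intro has_integral_le[OF integrable_integral[OF int] has_integral_weight]) auto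
  then show "4/3 * integral {0..1/2} ?w \<le> numerical_radius A" by simp
  fix t :: real
  assume "0 \<le> t \<and> t \<le> 1"
  define r where "r = min t (1 - t)"
  \<comment> \<open>Since \<open>t\<close> and \<open>1 - t\<close> sum to 1, the larger is
    \<open>1 - r\<close> and the smaller at most 1/2. Thus \<open>2 * R\<close> is the factor
    \<open>2 * (1 - s)\<close> of the earlier bounds at \<open>s = r\<close>.\<close>
  have R: "max t (1 - t) = 1 - r" and r: "r \<le> 1/2" unfolding r_def by linarith+
  have pos: "0 < 2 * (1 - r)" using r by simp
  have "onorm (real_part A) \<le> ?w r / (2 * (1 - r))"
    using onorm_real_part_le_weighted[OF assms r] pos
    by (simp add: pos_le_divide_eq mult.commute)
  moreover have "?w r / (2 * (1 - r)) \<le> numerical_radius A"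
    using weighted_numerical_radius_le[OF assms r] pos
    by (simp add: pos_divide_le_eq mult.commute)
  ultimately show "let r = min t (1 - t); R = max t (1 - t) in
      onorm (real_part A) \<le> ?w r / (2 * R) \<and> ?w r / (2 * R) \<le> numerical_radius A"
    by (simp add: Let_def R flip: r_def)
qed

end
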